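(* Let $d\ge 1$ be an integer. There exist an isometry invariant $\sigma$-algebra $\mathcal{A}$ of subsets of $\mathbb{R}^d$ containing all Borel subsets of $\mathbb{R}^d$, and an isometry invariant $\sigma$-finite measure $\mu$ defined on $\mathcal{A}$, such that for every $c\in[0,\infty)$ the restriction of $\mu$ to the Borel subsets of $\mathbb{R}^d$ is not equal to $c\,\lambda_d$.
   Context: $\lambda_d$ denotes $d$-dimensional Lebesgue measure. $\mathrm{Isom}(\mathbb{R}^d)$ is the group of isometries of $\mathbb{R}^d$. A $\sigma$-algebra $\mathcal{A}$ of subsets of $\mathbb{R}^d$ is isometry invariant if $\varphi(A)\in\mathcal{A}$ for every $A\in\mathcal{A}$ and every $\varphi\in\mathrm{Isom}(\mathbb{R}^d)$. A measure $\mu$ on such an $\mathcal{A}$ is isometry invariant if $\mu(\varphi(A))=\mu(A)$ for every $A\in\mathcal{A}$ and every $\varphi\in\mathrm{Isom}(\mathbb{R}^d)$. The measure $\mu$ is $\sigma$-finite if $\mathbb{R}^d$ is a countable union of members of $\mathcal{A}$ (not necessarily Borel sets) of finite $\mu$-measure. Measures take values in $[0,\infty]$. *)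

theory Defs
  imports "HOL-Analysis.Analysis"
begin

definition Isom :: "('a::metric_space \<Rightarrow> 'a) set" where
  "Isom = {\<phi>. surj \<phi> \<and> (\<forall>x y. dist (\<phi> x) (\<phi> y) = dist x y)}"

definition isometry_invariant_algebra :: "'a::metric_space set set \<Rightarrow> bool" where
  "isometry_invariant_algebra \<A> \<longleftrightarrow> (\<forall>\<phi>\<in>Isom. \<forall>A\<in>\<A>. \<phi> ` A \<in> \<A>)"

(* emeasure is 0 outside sets M, so this is the intended notion only when sets M is
   itself isometry invariant. *)
definition isometry_invariant_measure :: "'a::metric_space measure \<Rightarrow> bool" where
  "isometry_invariant_measure M \<longleftrightarrow>
    (\<forall>\<phi>\<in>Isom. \<forall>A\<in>sets M. emeasure M (\<phi> ` A) = emeasure M A)"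

end

theory Submission
  imports Defs
begin

text \<open>
  Call a set small if its cardinality is less than that of the continuum. Along a well-ordering of
  the continuum whose proper initial segments are small, a transfinite recursion in the style of
  Sierpinski produces disjoint sets \<open>A n\<close>, for \<open>n\<close> a natural number, such that every isometry
  moves only a small part of \<open>A n\<close> out of \<open>A n\<close>, and \<open>A n\<close> meets every closed set of positive
  measure in a set that is not small. By the first property the Lebesgue outer measure of the trace
  on \<open>A n\<close>, computed modulo small sets, is invariant under isometries; by the second it extends
  Lebesgue measure. The sum over \<open>n\<close> of these outer measures is infinite on the unit cube, yet
  sigma-finite on its Caratheodory sets, because each \<open>A n\<close> is one of them and is charged by a
  single summand.
\<close>

subsection \<open>Sets smaller than the continuum\<close>

text \<open>\<open>nat set\<close> stands for the continuum. The negated form makes a set that is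
  not small yield an injection from \<open>nat set\<close> at once; comparability of cardinals turns
  it into a strict inequality.\<close>

definition small :: "'a set \<Rightarrow> bool" where
  "small X \<longleftrightarrow> \<not> (UNIV :: nat set set) \<lesssim> X"

lemma small_iff_ordLess:
  "small X \<longleftrightarrow> ordLess2 (card_of X) (card_of (UNIV :: nat set set))"
  unfolding small_def lepoll_def by (rule card_of_ordLess)

lemma not_small_UNIV: "\<not> small (UNIV :: nat set set)"
  by (simp add: small_def)

lemma small_lepoll: "small Y \<Longrightarrow> X \<lesssim> Y \<Longrightarrow> small X"
  unfolding small_def using lepoll_trans by blast

lemma small_subset: "small Y \<Longrightarrow> X \<subseteq> Y \<Longrightarrow> small X"
  using small_lepoll subset_imp_lepoll by blast

lemma small_image: "small X \<Longrightarrow> small (f ` X)"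
  using small_lepoll image_lepoll by blast

lemma small_inj_image: "inj_on f X \<Longrightarrow> small (f ` X) \<Longrightarrow> small X"
  by (rule small_lepoll[of "f ` X"]) (auto simp: lepoll_def)

lemma small_finite: "finite X \<Longrightarrow> small X"
  unfolding small_def lepoll_def
  using inj_on_finite[of _ "UNIV :: nat set set" X] by (auto simp: Finite_Set.finite_set)

lemma small_empty [simp]: "small {}"
  by (simp add: small_finite)

text \<open>
  Koenig's diagonal argument: since the continuum equals its own countable power, its cofinality is
  uncountable.
\<close>

lemma small_UN:
  fixes X :: "nat \<Rightarrow> 'a set"
  assumes "\<And>n. small (X n)"
  shows "small (\<Union>n. X n)"
proof (rule ccontr)
  assume "\<not> small (\<Union>n. X n)"
  then obtain f :: "nat set \<Rightarrow> 'a" where f: "inj f" "range f \<subseteq> (\<Union>n. X n)"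
    unfolding small_def lepoll_def by auto
  \<comment> \<open>Pairing of naturals codes a sequence of subsets of \<open>nat\<close> as a
    single subset.\<close>
  define g :: "(nat \<Rightarrow> nat set) \<Rightarrow> nat set"
    where "g = (\<lambda>s. {k. snd (prod_decode k) \<in> s (fst (prod_decode k))})"
  have "inj g"
  proof
    fix s t :: "nat \<Rightarrow> nat set" assume "g s = g t"
    moreover have "prod_encode (n, k) \<in> g u \<longleftrightarrow> k \<in> u n" for n k u
      by (simp add: g_def)
    ultimately have "k \<in> s n \<longleftrightarrow> k \<in> t n" for n k
      by metis
    then show "s = t" by blast
  qed
  define h where "h = f \<circ> g"
  have h: "inj h" "range h \<subseteq> (\<Union>n. X n)"
    unfolding h_def using f \<open>inj g\<close> by (auto simp: inj_compose)
  \<comment> \<open>The \<open>n\<close>-th terms of the sequences decoded from \<open>X n\<close>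
    form a small set, so some \<open>c n\<close> differs from all of them. The code of
    \<open>c\<close> then lies in no \<open>X n\<close>.\<close>
  have "(\<lambda>y. inv h y n) ` X n \<noteq> UNIV" for n
    using small_image[OF assms] not_small_UNIV by metis
  then have "\<forall>n. \<exists>c. c \<notin> (\<lambda>y. inv h y n) ` X n" by blast
  then obtain c where c: "\<And>n. c n \<notin> (\<lambda>y. inv h y n) ` X n" by metis
  have "h c \<in> (\<Union>n. X n)" using h(2) by (rule subsetD) (rule rangeI)
  then obtain n where "h c \<in> X n" by (rule UN_E)
  then show False using c[of n] inv_f_f[OF h(1), of c] by (metis image_eqI)
qed

lemma small_Un: "small X \<Longrightarrow> small Y \<Longrightarrow> small (X \<union> Y)"
  unfolding small_iff_ordLess
  by (rule card_of_Un_ordLess_infinite) (simp_all add: Finite_Set.finite_set)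

lemma small_Times_aux:
  assumes "small Y" "X \<lesssim> Y"
  shows "small (X \<times> Y)"
proof (cases "finite Y")
  case True
  then have "finite X" using assms(2) inj_on_finite unfolding lepoll_def by blast
  then show ?thesis using True by (simp add: small_finite)
next
  case False
  have "X \<times> Y \<lesssim> Y \<times> Y" using assms(2) by (simp add: times_lepoll_mono)
  also have "Y \<times> Y \<approx> Y"
    using False by (simp add: card_of_Times_same_infinite eqpoll_iff_card_of_ordIso)
  finally show ?thesis using assms(1) small_lepoll by blast
qed

lemma small_Times:
  assumes "small X" "small Y"
  shows "small (X \<times> Y)"
proof -
  consider "X \<lesssim> Y" | "Y \<lesssim> X"
    unfolding lepoll_def card_of_ordLeq
    using ordLeq_total[OF card_of_Well_order card_of_Well_order] by blast
  then show ?thesis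
  proof cases
    case 1 then show ?thesis using small_Times_aux assms by blast
  next
    case 2
    then have "small ((\<lambda>(y, x). (x, y)) ` (Y \<times> X))"
      using small_image small_Times_aux assms by blast
    moreover have "(\<lambda>(y, x). (x, y)) ` (Y \<times> X) = X \<times> Y" by auto
    ultimately show ?thesis by simp
  qed
qed

text \<open>There are small many lists of each fixed length, by products, and a countable union of
  small sets is small.\<close>

lemma small_lists:
  assumes "small S"
  shows "small (lists S)"
proof -
  have "small {l \<in> lists S. length l = n}" for n
  proof (induction n)
    case 0
    have "{l \<in> lists S. length l = 0} \<subseteq> {[]}" by auto
    then show ?case by (meson finite.simps small_finite small_subset)
  next
    case (Suc n)
    have "{l \<in> lists S. length l = Suc n} \<subseteq> (\<lambda>(a, l). a # l) ` (S \<times> {l \<in> lists S. length l = n})"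
    proof
      fix l assume "l \<in> {l \<in> lists S. length l = Suc n}"
      then obtain a k where "l = a # k" "a \<in> S" "k \<in> lists S" "length k = n"
        by (cases l) auto
      then show "l \<in> (\<lambda>(a, l). a # l) ` (S \<times> {l \<in> lists S. length l = n})"
        by (intro image_eqI[of _ _ "(a, k)"]) auto
    qed
    moreover have "small ((\<lambda>(a, l). a # l) ` (S \<times> {l \<in> lists S. length l = n}))"
      by (intro small_image small_Times assms Suc)
    ultimately show ?case by (rule small_subset[rotated])
  qed
  then have "small (\<Union>n. {l \<in> lists S. length l = n})" by (rule small_UN)
  moreover have "(\<Union>n. {l \<in> lists S. length l = n}) = lists S" by auto
  ultimately show ?thesis by simp
qed

section \<open>Counting closed sets, and the size of closed sets of positive measure\<close>

lemma prod_lepoll_continuum: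
  assumes "A \<lesssim> (UNIV :: nat set set)" "B \<lesssim> (UNIV :: nat set set)"
  shows "A \<times> B \<lesssim> (UNIV :: nat set set)"
proof -
  have "A \<times> B \<lesssim> (UNIV :: nat set set) \<times> (UNIV :: nat set set)"
    using assms by (rule times_lepoll_mono)
  also have "\<dots> \<approx> (UNIV :: nat set set)"
    unfolding eqpoll_iff_card_of_ordIso
    by (rule card_of_Times_same_infinite) (simp add: Finite_Set.finite_set)
  finally show ?thesis .
qed

text \<open>A closed set is coded by the indices of the members of a countable basis that miss it:
  their union is its complement.\<close>

lemma closed_sets_lepoll_continuum:
  "{F :: 'a :: second_countable_topology set. closed F} \<lesssim> (UNIV :: nat set set)"
proof -
  obtain B :: "'a set set" where B: "countable B" "topological_basis B"
    using ex_countable_basis by blast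
  define f :: "'a set \<Rightarrow> nat set" where "f = (\<lambda>F. {n. from_nat_into B n \<inter> F = {}})"
  have *: "- F = (\<Union>n\<in>f F. from_nat_into B n)" if "closed F" for F
  proof (intro equalityI subsetI)
    fix x assume "x \<in> - F"
    then obtain b where b: "b \<in> B" "x \<in> b" "b \<subseteq> - F"
      using topological_basisE[OF B(2) open_Compl[OF \<open>closed F\<close>], of x] \<open>x \<in> - F\<close> by metis
    obtain n where "from_nat_into B n = b" using from_nat_into_surj[OF B(1) b(1)] by (elim exE)
    then show "x \<in> (\<Union>n\<in>f F. from_nat_into B n)" using b by (auto simp: f_def)
  qed (auto simp: f_def)
  have "inj_on f {F. closed F}"
  proof (rule inj_onI)
    fix F G assume "F \<in> {F. closed F}" "G \<in> {F. closed F}" "f F = f G"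
    then have "- F = - G" using *[of F] *[of G] by simp
    then show "F = G" by simp
  qed
  then show ?thesis unfolding lepoll_def by blast
qed

text \<open>The points all of whose neighbourhoods meet \<open>F\<close> in positive measure form a perfect set.\<close>

lemma not_small_closed:
  fixes F :: "'a :: euclidean_space set"
  assumes F: "closed F" and pos: "emeasure lborel F \<noteq> 0"
  shows "\<not> small F"
proof -
  obtain B :: "'a set set" where B: "countable B" "topological_basis B"
    using ex_countable_basis by blast
  \<comment> \<open>Removing from \<open>F\<close> these countably many null pieces leaves
    \<open>S\<close>, the support of Lebesgue measure restricted to \<open>F\<close>.\<close>
  define N where "N = {b \<in> B. emeasure lborel (F \<inter> b) = 0}"
  define S where "S = F - \<Union> N"
  have openB: "open b" if "b \<in> B" for b using that B(2) topological_basis_open by blast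
  have "open (\<Union> N)" using openB by (auto simp: N_def)
  have "F \<in> sets borel" using F by simp
  have null: "F \<inter> \<Union> N \<in> null_sets lborel"
  proof -
    have "(\<Union>b\<in>N. F \<inter> b) \<in> null_sets lborel"
    proof (rule null_sets_UN')
      show "countable N" unfolding N_def using B(1) by auto
      show "F \<inter> b \<in> null_sets lborel" if "b \<in> N" for b
        using that openB[of b] \<open>F \<in> sets borel\<close> by (auto simp: N_def null_sets_def)
    qed
    moreover have "(\<Union>b\<in>N. F \<inter> b) = F \<inter> \<Union> N" by blast
    ultimately show ?thesis by metis
  qed
  have eq: "emeasure lborel (S \<inter> U) = emeasure lborel (F \<inter> U)" if "open U" for U
  proof -
    have "emeasure lborel (F \<inter> U - F \<inter> \<Union> N) = emeasure lborel (F \<inter> U)"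
      using that \<open>F \<in> sets borel\<close> by (intro emeasure_Diff_null_set null) auto
    moreover have "F \<inter> U - F \<inter> \<Union> N = S \<inter> U" by (auto simp: S_def)
    ultimately show ?thesis by simp
  qed
  have "S \<noteq> {}" using eq[of UNIV] pos by auto
  have "closed S" unfolding S_def using F \<open>open (\<Union> N)\<close> by auto
  have "x islimpt S" if "x \<in> S" for x
  proof (rule islimptI)
    fix U assume "x \<in> U" "open U"
    then obtain b where b: "b \<in> B" "x \<in> b" "b \<subseteq> U"
      using topological_basisE[OF B(2)] by metis
    then have "emeasure lborel (S \<inter> b) \<noteq> 0"
      using that eq[OF openB] by (auto simp: S_def N_def)
    \<comment> \<open>Singletons are null, so \<open>x\<close> cannot be isolated in
      \<open>S\<close>.\<close>
    then have "\<not> S \<inter> b \<subseteq> {x}"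
      by (metis emeasure_empty emeasure_lborel_singleton subset_singletonD)
    then show "\<exists>y\<in>S. y \<in> U \<and> y \<noteq> x" using b by blast
  qed
  moreover have "x \<in> euclidean derived_set_of S \<longleftrightarrow> x islimpt S" for x
    unfolding in_derived_set_of islimpt_def by (simp, blast)
  ultimately have "euclidean derived_set_of S = S"
    using \<open>closed S\<close> unfolding closed_limpt by blast
  then have "(UNIV :: real set) \<lesssim> S"
    using lepoll_perfect_set[OF disjI1[OF completely_metrizable_space_euclidean]] \<open>S \<noteq> {}\<close> by metis
  then have "\<not> small S"
    using lepoll_trans1[OF nat_sets_eqpoll_reals] by (simp add: small_def)
  then show ?thesis using small_subset[of F S] by (auto simp: S_def)
qed

subsection \<open>Almost invariant families\<close>

text \<open>The monoid generated by \<open>S\<close> under composition, without inverses. Presenting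
  it as an image of \<open>lists S\<close> bounds its cardinality.\<close>

definition words :: "('a \<Rightarrow> 'a) set \<Rightarrow> ('a \<Rightarrow> 'a) set" where
  "words S = (\<lambda>l. foldr (\<circ>) l id) ` lists S"

lemma id_in_words: "id \<in> words S"
  unfolding words_def by (rule image_eqI[of _ _ "[]"]) auto

lemma comp_in_words:
  assumes "f \<in> S" "w \<in> words S"
  shows "f \<circ> w \<in> words S"
proof -
  obtain l where "l \<in> lists S" "w = foldr (\<circ>) l id" using assms(2) by (auto simp: words_def)
  then show ?thesis unfolding words_def by (intro image_eqI[of _ _ "f # l"]) (use assms(1) in auto)
qed

lemma words_mono: "S \<subseteq> T \<Longrightarrow> words S \<subseteq> words T"
  unfolding words_def using lists_mono by blast

lemma small_words: "small S \<Longrightarrow> small (words S)"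
  unfolding words_def by (intro small_image small_lists)

lemma inj_words:
  assumes "\<And>f. f \<in> S \<Longrightarrow> inj f" "w \<in> words S"
  shows "inj w"
proof -
  obtain l where "l \<in> lists S" and w: "w = foldr (\<circ>) l id" using assms(2) by (auto simp: words_def)
  from \<open>l \<in> lists S\<close> have "inj (foldr (\<circ>) l id)"
  proof induction
    case (Cons a l)
    then have "inj (a \<circ> foldr (\<circ>) l id)" by (metis inj_compose assms(1))
    moreover have "foldr (\<circ>) (a # l) id = a \<circ> foldr (\<circ>) l id" by (simp add: fun_eq_iff)
    ultimately show ?case by metis
  qed simp
  then show ?thesis by (simp add: w)
qed

text \<open>A fixed element of \<open>A\<close> replaces values outside \<open>A\<close>. This
  supplies enumerations, possibly with repetitions, indexed by all of
  \<open>nat set\<close>.\<close>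

lemma lepoll_obtain_range:
  assumes "A \<lesssim> B" "A \<noteq> {}"
  obtains g where "g ` B = A"
proof -
  obtain h where h: "A \<subseteq> h ` B" using assms(1) unfolding lepoll_iff by (elim exE)
  obtain a where "a \<in> A" using assms(2) by blast
  define g where "g x = (if h x \<in> A then h x else a)" for x
  have "g ` B \<subseteq> A" using \<open>a \<in> A\<close> by (simp add: g_def image_subset_iff)
  moreover have "A \<subseteq> g ` B"
  proof
    fix x assume "x \<in> A"
    then obtain y where "y \<in> B" "x = h y" using h by blast
    then show "x \<in> g ` B" using \<open>x \<in> A\<close> by (intro image_eqI[of _ _ y]) (simp_all add: g_def)
  qed
  ultimately show ?thesis by (intro that subset_antisym)
qed

text \<open>At each stage a new point is chosen in the current target set, unrelated to all earlier
  points by words in the maps listed so far. The orbits of distinct stages are then disjoint, and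
  \<open>A n\<close> collects those of the stages numbered \<open>n\<close>.\<close>

lemma almost_invariant_family:
  fixes \<Phi> :: "('a \<Rightarrow> 'a) set" and \<F> :: "'a set set"
  assumes \<Phi>: "\<Phi> \<lesssim> (UNIV :: nat set set)" and inj: "\<And>f. f \<in> \<Phi> \<Longrightarrow> inj f"
    and "\<Phi> \<noteq> {}"
    and \<F>: "\<F> \<lesssim> (UNIV :: nat set set)" and large: "\<And>F. F \<in> \<F> \<Longrightarrow> \<not> small F"
    and "\<F> \<noteq> {}"
  obtains A :: "nat \<Rightarrow> 'a set"
  where "disjoint_family A"
    and "\<And>f n. f \<in> \<Phi> \<Longrightarrow> small (f ` A n - A n)"
    and "\<And>F n. F \<in> \<F> \<Longrightarrow> \<not> small (A n \<inter> F)"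
proof -
  \<comment> \<open>A cardinal well-order of the continuum: each proper initial segment
    \<open>U \<alpha>\<close> is small.\<close>
  define r :: "nat set rel" where "r = card_of UNIV"
  have co: "Card_order r" unfolding r_def by (rule card_of_Card_order)
  have fld: "Field r = UNIV" unfolding r_def by (rule Field_card_of)
  have wo: "Well_order r" unfolding r_def by (rule card_of_Well_order)
  have lin: "Linear_order r" using wo well_order_on_def by blast
  have wfr: "wf (r - Id)" using wo well_order_on_def by blast
  define U where "U = underS r"
  have small_U: "small (U \<alpha>)" for \<alpha>
    using card_of_underS[OF co, of \<alpha>] unfolding small_iff_ordLess U_def r_def Field_card_of by blast
  have U_iff: "\<beta> \<in> U \<alpha> \<longleftrightarrow> (\<beta>, \<alpha>) \<in> r - Id" for \<alpha> \<beta> by (auto simp: U_def underS_def)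
  have U_total: "\<alpha> \<in> U \<beta> \<or> \<beta> \<in> U \<alpha>" if "\<alpha> \<noteq> \<beta>" for \<alpha> \<beta>
    using lin that fld by (auto simp: U_iff order_on_defs total_on_def)
  have U_mono: "U \<alpha> \<subseteq> U \<beta>" if "\<alpha> \<in> U \<beta>" for \<alpha> \<beta>
    using lin that unfolding U_iff order_on_defs by (auto simp: U_iff dest: transD antisymD)
  obtain p :: "nat set \<Rightarrow> 'a \<Rightarrow> 'a" where p: "range p = \<Phi>"
    by (rule lepoll_obtain_range[OF \<Phi> \<open>\<Phi> \<noteq> {}\<close>])
  have "\<F> \<times> (UNIV :: nat set) \<times> (UNIV :: nat set set) \<lesssim> (UNIV :: nat set set)"
    using lesspoll_imp_lepoll[OF lesspoll_Pow_self[of "UNIV :: nat set"]]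
    by (intro prod_lepoll_continuum \<F> lepoll_refl) simp
  moreover have "\<F> \<times> (UNIV :: nat set) \<times> (UNIV :: nat set set) \<noteq> {}"
    using \<open>\<F> \<noteq> {}\<close> by simp
  ultimately obtain e :: "nat set \<Rightarrow> 'a set \<times> nat \<times> nat set" where e: "range e = \<F> \<times> UNIV \<times> UNIV"
    by (rule lepoll_obtain_range)
  \<comment> \<open>The third component makes every pair of a target and an index occur continuum many times.\<close>
  define tgt num where "tgt = fst \<circ> e" and "num = fst \<circ> snd \<circ> e"
  have tgt: "tgt \<alpha> \<in> \<F>" for \<alpha>
    using e rangeI[of e \<alpha>] unfolding tgt_def by (cases "e \<alpha>") auto
  define W where "W \<alpha> = words (p ` U \<alpha>)" for \<alpha>
  have small_W: "small (W \<alpha>)" for \<alpha>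
    unfolding W_def by (intro small_words small_image small_U)
  have inj_W: "inj w" if "w \<in> W \<alpha>" for w \<alpha>
    using inj_words[of "p ` U \<alpha>" w] that inj p unfolding W_def by blast
  have W_mono: "W \<alpha> \<subseteq> W \<beta>" if "\<alpha> \<in> U \<beta>" for \<alpha> \<beta>
    using words_mono[of "p ` U \<alpha>" "p ` U \<beta>"] U_mono[OF that] unfolding W_def by blast
  \<comment> \<open>The points whose orbit under \<open>W \<alpha>\<close> meets that of an earlier
    point. Words on both sides replace inverses, as the maps are only known to be injective.\<close>
  define bad where "bad x \<alpha> = {z. \<exists>\<beta>\<in>U \<alpha>. \<exists>v\<in>W \<alpha>. \<exists>w\<in>W \<alpha>. v z = w (x \<beta>)}" for x \<alpha>
  have "\<exists>x. \<forall>\<alpha>. x \<alpha> \<in> tgt \<alpha> - bad x \<alpha>"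
  \<comment> \<open>Recursion is legitimate because \<open>bad x \<alpha>\<close> depends on
    \<open>x\<close> only below \<open>\<alpha>\<close>.\<close>
  proof (rule dependent_wf_choice[OF wfr])
    fix x y :: "nat set \<Rightarrow> 'a" and \<alpha> z
    assume "\<And>\<beta>. (\<beta>, \<alpha>) \<in> r - Id \<Longrightarrow> x \<beta> = y \<beta>"
    then have "bad x \<alpha> = bad y \<alpha>" unfolding bad_def U_iff[symmetric] by auto
    then show "(z \<in> tgt \<alpha> - bad x \<alpha>) = (z \<in> tgt \<alpha> - bad y \<alpha>)" by simp
  next
    fix x :: "nat set \<Rightarrow> 'a" and \<alpha>
    \<comment> \<open>By injectivity of \<open>v\<close>, a bad point is determined by a triple of
      an earlier stage and two words, so a target, not being small, contains a good point.\<close>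
    have "small (U \<alpha> \<times> W \<alpha> \<times> W \<alpha>)" by (intro small_Times small_U small_W)
    moreover have "bad x \<alpha> \<subseteq> (\<lambda>(\<beta>, v, w). inv v (w (x \<beta>))) ` (U \<alpha> \<times> W \<alpha> \<times> W \<alpha>)"
    proof
      fix z assume "z \<in> bad x \<alpha>"
      then obtain \<beta> v w where *: "\<beta> \<in> U \<alpha>" "v \<in> W \<alpha>" "w \<in> W \<alpha>" "v z = w (x \<beta>)"
        unfolding bad_def by blast
      then have "z = inv v (w (x \<beta>))" using inj_W inv_f_f by metis
      then show "z \<in> (\<lambda>(\<beta>, v, w). inv v (w (x \<beta>))) ` (U \<alpha> \<times> W \<alpha> \<times> W \<alpha>)"
        using * by (intro image_eqI[of _ _ "(\<beta>, v, w)"]) auto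
    qed
    ultimately have "small (bad x \<alpha>)" using small_image small_subset by blast
    then have "\<not> tgt \<alpha> \<subseteq> bad x \<alpha>" using large[OF tgt] small_subset by blast
    then show "\<exists>z. z \<in> tgt \<alpha> - bad x \<alpha>" by blast
  qed
  then obtain x where x_in: "\<And>\<alpha>. x \<alpha> \<in> tgt \<alpha>" and x_bad: "\<And>\<alpha>. x \<alpha> \<notin> bad x \<alpha>" by blast
  have clash: False if "\<beta> \<in> U \<alpha>" "v \<in> W \<alpha>" "w \<in> W \<beta>" "v (x \<alpha>) = w (x \<beta>)" for \<alpha> \<beta> v w
    using x_bad[of \<alpha>] that W_mono[OF that(1)] unfolding bad_def by blast
  define A where "A n = (\<Union>\<alpha>\<in>{\<alpha>. num \<alpha> = n}. (\<lambda>w. w (x \<alpha>)) ` W \<alpha>)" for n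
  show ?thesis
  proof (rule that[of A])
    have "m = n" if "y \<in> A m" "y \<in> A n" for m n y
    proof -
      obtain \<alpha> v where 1: "num \<alpha> = m" "v \<in> W \<alpha>" "y = v (x \<alpha>)" using \<open>y \<in> A m\<close> unfolding A_def by blast
      obtain \<beta> w where 2: "num \<beta> = n" "w \<in> W \<beta>" "y = w (x \<beta>)" using \<open>y \<in> A n\<close> unfolding A_def by blast
      have "\<alpha> = \<beta>" using U_total[of \<alpha> \<beta>] clash[of \<beta> \<alpha> v w] clash[of \<alpha> \<beta> w v] 1 2 by metis
      then show ?thesis using 1 2 by simp
    qed
    then show "disjoint_family A" unfolding disjoint_family_on_def by blast
  next
    fix f n assume "f \<in> \<Phi>"
    then obtain \<gamma> where \<gamma>: "f = p \<gamma>" using p by blast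
    \<comment> \<open>Only the orbit pieces of stages up to \<open>\<gamma>\<close> can be moved out of \<open>A n\<close> by \<open>f\<close>.\<close>
    have "f ` A n - A n \<subseteq> (\<lambda>(w, \<alpha>). f (w (x \<alpha>))) ` (W \<gamma> \<times> insert \<gamma> (U \<gamma>))"
    proof
      fix y assume y: "y \<in> f ` A n - A n"
      then obtain \<alpha> w where 1: "num \<alpha> = n" "w \<in> W \<alpha>" "y = f (w (x \<alpha>))" unfolding A_def by blast
      \<comment> \<open>At stages after \<open>\<gamma>\<close> the map \<open>f\<close> is among
        the generators, so the orbit piece is closed under \<open>f\<close>.\<close>
      have "\<gamma> \<notin> U \<alpha>"
      proof
        assume "\<gamma> \<in> U \<alpha>"
        then have "f \<circ> w \<in> W \<alpha>" using comp_in_words[of f "p ` U \<alpha>" w] 1(2) \<gamma> unfolding W_def by blast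
        moreover have "y = (f \<circ> w) (x \<alpha>)" using 1(3) by simp
        ultimately have "y \<in> A n" unfolding A_def using 1(1) by blast
        then show False using y by blast
      qed
      then have "\<alpha> \<in> insert \<gamma> (U \<gamma>)" using U_total by blast
      moreover have "w \<in> W \<gamma>" using calculation 1(2) W_mono by blast
      ultimately show "y \<in> (\<lambda>(w, \<alpha>). f (w (x \<alpha>))) ` (W \<gamma> \<times> insert \<gamma> (U \<gamma>))"
        using 1(3) by (intro image_eqI[of _ _ "(w, \<alpha>)"]) auto
    qed
    moreover have "small (insert \<gamma> (U \<gamma>))"
      using small_Un[OF small_finite[of "{\<gamma>}"] small_U[of \<gamma>]] by simp
    then have "small (W \<gamma> \<times> insert \<gamma> (U \<gamma>))" by (rule small_Times[OF small_W])
    then have "small ((\<lambda>(w, \<alpha>). f (w (x \<alpha>))) ` (W \<gamma> \<times> insert \<gamma> (U \<gamma>)))"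
      by (rule small_image)
    ultimately show "small (f ` A n - A n)" by (rule small_subset[rotated])
  next
    fix F n assume "F \<in> \<F>"
    define T where "T = {\<alpha>. tgt \<alpha> = F \<and> num \<alpha> = n}"
    have "t \<in> (snd \<circ> snd \<circ> e) ` T" for t
    proof -
      have "(F, n, t) \<in> range e" using e \<open>F \<in> \<F>\<close> by simp
      then obtain \<alpha> where "e \<alpha> = (F, n, t)" by (metis imageE)
      then show ?thesis
        by (intro image_eqI[of _ _ \<alpha>]) (auto simp: T_def tgt_def num_def)
    qed
    then have "\<not> small T" using small_image[of T "snd \<circ> snd \<circ> e"] not_small_UNIV by (metis UNIV_eq_I)
    moreover have "inj x"
    proof
      fix \<alpha> \<beta> assume "x \<alpha> = x \<beta>"
      then show "\<alpha> = \<beta>"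
        \<comment> \<open>Equal points at distinct stages would be a clash with both words the
          identity.\<close>
        using U_total[of \<alpha> \<beta>] clash[of \<beta> \<alpha> id id] clash[of \<alpha> \<beta> id id] id_in_words
        unfolding W_def by (metis id_apply)
    qed
    ultimately have "\<not> small (x ` T)" using small_inj_image[of x T] inj_on_subset by blast
    moreover have "x ` T \<subseteq> A n \<inter> F"
    proof
      fix y assume "y \<in> x ` T"
      then obtain \<alpha> where "\<alpha> \<in> T" "y = x \<alpha>" by blast
      moreover have "x \<alpha> \<in> (\<lambda>w. w (x \<alpha>)) ` W \<alpha>"
        unfolding W_def by (rule image_eqI[of _ _ id]) (auto simp: id_in_words)
      ultimately show "y \<in> A n \<inter> F"
        unfolding T_def A_def using x_in by blast
    qed
    ultimately show "\<not> small (A n \<inter> F)" using small_subset by blast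
  qed
qed

subsection \<open>Isometries and Lebesgue measure\<close>

lemma Isom_dist: "f \<in> Isom \<Longrightarrow> dist (f x) (f y) = dist x y"
  by (simp add: Isom_def)

lemma Isom_inj: "f \<in> Isom \<Longrightarrow> inj f"
  by (metis Isom_dist dist_eq_0_iff injI)

lemma Isom_bij: "f \<in> Isom \<Longrightarrow> bij f"
  by (simp add: Isom_inj bij_def) (simp add: Isom_def)

lemma Isom_inv:
  assumes "f \<in> Isom"
  shows "inv f \<in> Isom"
proof -
  have s: "surj f" using assms by (simp add: Isom_def)
  have "dist (inv f x) (inv f y) = dist x y" for x y
    using Isom_dist[OF assms, of "inv f x" "inv f y"] by (simp add: surj_f_inv_f[OF s])
  moreover have "surj (inv f)" using Isom_inj[OF assms] by (rule inj_imp_surj_inv)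
  ultimately show ?thesis by (simp add: Isom_def)
qed

lemma Isom_continuous: "f \<in> Isom \<Longrightarrow> continuous_on S f"
  unfolding continuous_on_iff by (metis Isom_dist)

lemma Isom_borel_image:
  fixes f :: "'a :: metric_space \<Rightarrow> 'a"
  assumes "f \<in> Isom" "C \<in> sets borel"
  shows "f ` C \<in> sets borel"
proof -
  have "inv f \<in> borel_measurable borel"
    using Isom_continuous[OF Isom_inv[OF assms(1)]] by (rule borel_measurable_continuous_onI)
  from measurable_sets[OF this assms(2)] have "inv f -` C \<in> sets borel" by simp
  moreover have "inv f -` C = f ` C"
    by (rule bij_vimage_eq_inv_image[OF Isom_bij[OF Isom_inv[OF assms(1)]],
      unfolded inv_inv_eq[OF Isom_bij[OF assms(1)]]])
  ultimately show ?thesis by simp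
qed

text \<open>An isometry is determined by its graph, which is closed in the product space.\<close>

lemma Isom_lepoll_continuum:
  "(Isom :: ('a :: euclidean_space \<Rightarrow> 'a) set) \<lesssim> (UNIV :: nat set set)"
proof -
  define graph where "graph f = range (\<lambda>x. (x, f x))" for f :: "'a \<Rightarrow> 'a"
  have "inj_on graph Isom"
  proof (rule inj_onI)
    fix f g assume "graph f = graph g"
    then have "(x, f x) \<in> range (\<lambda>x. (x, g x))" for x unfolding graph_def by auto
    then show "f = g" by auto
  qed
  moreover have "graph ` Isom \<subseteq> {F. closed F}"
    unfolding graph_def by (auto intro!: continuous_closed_graph Isom_continuous)
  ultimately have "(Isom :: ('a \<Rightarrow> 'a) set) \<lesssim> {F :: ('a \<times> 'a) set. closed F}"
    unfolding lepoll_def by blast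
  also have "\<dots> \<lesssim> (UNIV :: nat set set)" by (rule closed_sets_lepoll_continuum)
  finally show ?thesis .
qed

section \<open>Isometries do not increase Lebesgue measure\<close>

lemma Isom_image_cball:
  assumes "f \<in> Isom"
  shows "f ` cball x r = cball (f x) r"
proof (intro equalityI subsetI)
  fix y assume y: "y \<in> cball (f x) r"
  obtain z where z: "y = f z" using Isom_bij[OF assms] by (metis bij_pointE)
  then show "y \<in> f ` cball x r" using y Isom_dist[OF assms] by (intro image_eqI[of _ _ z]) auto
qed (use Isom_dist[OF assms] in auto)

lemma Isom_negligible_image:
  fixes f :: "'a :: euclidean_space \<Rightarrow> 'a"
  assumes "f \<in> Isom" "negligible N"
  shows "negligible (f ` N)"
proof (rule negligible_locally_Lipschitz_image)
  fix x
  have "norm (f y - f x) \<le> 1 * norm (y - x)" for y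
    using Isom_dist[OF assms(1), of y x] by (simp add: dist_norm)
  then show "\<exists>T B. open T \<and> x \<in> T \<and> (\<forall>y\<in>N \<inter> T. norm (f y - f x) \<le> B * norm (y - x))"
    by (intro exI[of _ UNIV] exI[of _ 1]) auto
qed (use assms in auto)

text \<open>
  By the Vitali covering theorem an open set is, up to a null set, a disjoint union of balls, and
  an isometry maps a ball to a ball of the same radius.
\<close>

lemma emeasure_Isom_image_open_le:
  fixes f :: "'a :: euclidean_space \<Rightarrow> 'a"
  assumes f: "f \<in> Isom" and U: "open U"
  shows "emeasure lborel (f ` U) \<le> emeasure lborel U"
proof -
  define K where "K = {p :: 'a \<times> real. 0 < snd p \<and> cball (fst p) (snd p) \<subseteq> U}"
  define b where "b p = cball (fst p) (snd p)" for p :: "'a \<times> real"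
  have fine: "\<exists>p. p \<in> K \<and> x \<in> cball (fst p) (snd p) \<and> snd p < d" if x: "x \<in> U" and d: "0 < d" for x d
  proof -
    obtain e where e: "e > 0" "cball x e \<subseteq> U" using U x open_contains_cball by blast
    \<comment> \<open>Halving \<open>d\<close> gives the strict bound on the radius that a Vitali
      cover requires.\<close>
    have "cball x (min e (d / 2)) \<subseteq> cball x e" by auto
    then show ?thesis
      using e d by (intro exI[of _ "(x, min e (d / 2))"]) (auto simp: K_def)
  qed
  have K_pos: "0 < snd p" if "p \<in> K" for p using that by (simp add: K_def)
  obtain C where C: "countable C" "C \<subseteq> K" "pairwise (\<lambda>p q. disjnt (b p) (b q)) C"
    "negligible (U - (\<Union>p\<in>C. b p))"
    unfolding b_def by (rule Vitali_covering_theorem_cballs[OF K_pos fine])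
  define N where "N = U - (\<Union>p\<in>C. b p)"
  have pos: "0 < snd p" and sub: "b p \<subseteq> U" if "p \<in> C" for p
    using C(2) that by (auto simp: K_def b_def)
  have disj: "disjoint_family_on b C"
    using C(3) by (auto simp: pairwise_def disjnt_def disjoint_family_on_def)
  have disj': "disjoint_family_on (\<lambda>p. f ` b p) C"
    using disj Isom_inj[OF f] unfolding disjoint_family_on_def
    by (metis image_Int image_empty)
  have fb: "f ` b p = cball (f (fst p)) (snd p)" for p
    unfolding b_def by (rule Isom_image_cball[OF f])
  have meas_b: "b p \<in> sets borel" for p by (simp add: b_def)
  have same: "emeasure lborel (f ` b p) = emeasure lborel (b p)" if "p \<in> C" for p
    unfolding fb unfolding b_def using pos[OF that] by (simp add: emeasure_cball)
  have "emeasure lborel (\<Union>p\<in>C. f ` b p) = (\<integral>\<^sup>+p. emeasure lborel (f ` b p) \<partial>count_space C)"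
    using C(1) disj' by (intro emeasure_UN_countable) (auto simp: fb)
  also have "\<dots> = (\<integral>\<^sup>+p. emeasure lborel (b p) \<partial>count_space C)"
    using same by (intro nn_integral_cong) simp
  also have "\<dots> = emeasure lborel (\<Union>p\<in>C. b p)"
    using C(1) disj meas_b by (intro emeasure_UN_countable[symmetric]) auto
  also have "\<dots> \<le> emeasure lborel U"
    using sub U by (intro emeasure_mono) auto
  finally have le: "emeasure lborel (\<Union>p\<in>C. f ` b p) \<le> emeasure lborel U" .
  have "N \<in> sets borel" unfolding N_def using U C(1)
    by (intro sets.Diff sets.countable_UN') (auto simp: b_def)
  then have fN: "f ` N \<in> sets borel" by (rule Isom_borel_image[OF f])
  have "negligible (f ` N)" using Isom_negligible_image[OF f] C(4) unfolding N_def by blast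
  then have null: "emeasure lborel (f ` N) = 0"
    using fN by (simp add: negligible_iff_emeasure0)
  have meas: "(\<Union>p\<in>C. f ` b p) \<in> sets borel"
    using C(1) by (intro sets.countable_UN') (auto simp: fb)
  have "f ` U \<subseteq> (\<Union>p\<in>C. f ` b p) \<union> f ` N" unfolding N_def by blast
  then have "emeasure lborel (f ` U) \<le> emeasure lborel ((\<Union>p\<in>C. f ` b p) \<union> f ` N)"
    using meas fN by (intro emeasure_mono) auto
  also have "\<dots> \<le> emeasure lborel (\<Union>p\<in>C. f ` b p) + emeasure lborel (f ` N)"
    using meas fN by (intro emeasure_subadditive) auto
  finally show ?thesis using le null by simp
qed

text \<open>Outer regularity reduces the claim to open sets. An inequality suffices, since it also
  applies to the inverse isometry.\<close>

lemma emeasure_Isom_image_le: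
  fixes f :: "'a :: euclidean_space \<Rightarrow> 'a"
  assumes f: "f \<in> Isom" and C: "C \<in> sets borel"
  shows "emeasure lborel (f ` C) \<le> emeasure lborel C"
proof (rule ennreal_le_epsilon)
  fix e :: real assume "0 < e"
  obtain U where U: "open U" "C \<subseteq> U" "emeasure lborel (U - C) < ennreal e"
    using outer_regular_lborel[OF C \<open>0 < e\<close>] by metis
  have "emeasure lborel (f ` C) \<le> emeasure lborel (f ` U)"
    using U Isom_borel_image[OF f, of U] by (intro emeasure_mono) auto
  also have "\<dots> \<le> emeasure lborel U" by (rule emeasure_Isom_image_open_le[OF f U(1)])
  also have "U = C \<union> (U - C)" using U(2) by blast
  also have "emeasure lborel (C \<union> (U - C)) \<le> emeasure lborel C + emeasure lborel (U - C)"
    using U(1) C by (intro emeasure_subadditive) auto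
  also have "\<dots> \<le> emeasure lborel C + ennreal e"
    using U(3) by (intro add_left_mono) simp
  finally show "emeasure lborel (f ` C) \<le> emeasure lborel C + ennreal e" .
qed

subsection \<open>Outer measure of traces modulo small sets\<close>

text \<open>Neglecting small sets absorbs the failure of \<open>A\<close> to be exactly invariant;
  as small sets are closed under countable unions, countable subadditivity survives.\<close>

definition trace_outer :: "'a::euclidean_space set \<Rightarrow> 'a set \<Rightarrow> ennreal" where
  "trace_outer A S = (INF C\<in>{C \<in> sets borel. small (S \<inter> A - C)}. emeasure lborel C)"

lemma trace_outer_le:
  "C \<in> sets borel \<Longrightarrow> small (S \<inter> A - C) \<Longrightarrow> trace_outer A S \<le> emeasure lborel C"
  unfolding trace_outer_def by (rule INF_lower) simp

text \<open>The infimum is attained: intersect a minimizing sequence of covers; the union of their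
  exceptional sets is still small.\<close>

lemma trace_outer_hull:
  obtains C where "C \<in> sets borel" "small (S \<inter> A - C)" "emeasure lborel C = trace_outer A S"
proof -
  define H where "H = {C \<in> sets borel. small (S \<inter> A - C)}"
  have "UNIV \<in> H" unfolding H_def by simp
  then obtain a :: "nat \<Rightarrow> ennreal" where a: "range a \<subseteq> emeasure lborel ` H" "trace_outer A S = (INF i. a i)"
    unfolding trace_outer_def H_def[symmetric]
    using ennreal_Inf_countable_INF[of "emeasure lborel ` H"] by auto
  then have "\<forall>i. \<exists>C. C \<in> H \<and> a i = emeasure lborel C" by blast
  then obtain C where C: "\<And>i. C i \<in> H" "\<And>i. a i = emeasure lborel (C i)" by metis
  have 1: "(\<Inter>i. C i) \<in> sets borel" using C(1) by (intro sets.countable_INT) (auto simp: H_def)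
  have "small (\<Union>i. S \<inter> A - C i)" using C(1) by (intro small_UN) (auto simp: H_def)
  moreover have "(\<Union>i. S \<inter> A - C i) = S \<inter> A - (\<Inter>i. C i)" by auto
  ultimately have 2: "small (S \<inter> A - (\<Inter>i. C i))" by simp
  have "emeasure lborel (\<Inter>i. C i) \<le> trace_outer A S"
    unfolding a(2) C(2) using C(1) by (intro INF_greatest emeasure_mono) (auto simp: H_def)
  then show ?thesis using that[OF 1 2] trace_outer_le[OF 1 2] by (simp add: antisym)
qed

lemma trace_outer_mono: "S \<inter> A \<subseteq> T \<Longrightarrow> trace_outer A S \<le> trace_outer A T"
proof -
  assume "S \<inter> A \<subseteq> T"
  obtain C where C: "C \<in> sets borel" "small (T \<inter> A - C)" "emeasure lborel C = trace_outer A T"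
    by (rule trace_outer_hull)
  have "S \<inter> A - C \<subseteq> T \<inter> A - C" using \<open>S \<inter> A \<subseteq> T\<close> by blast
  then have "trace_outer A S \<le> emeasure lborel C"
    using C(1,2) small_subset by (intro trace_outer_le)
  then show ?thesis by (simp only: C(3))
qed

lemma trace_outer_disjoint: "S \<inter> A = {} \<Longrightarrow> trace_outer A S = 0"
  using trace_outer_le[of "{}" S A] by simp

lemma trace_outer_subadditive: "trace_outer A (\<Union>k. S k) \<le> (\<Sum>k. trace_outer A (S k))" for S :: "nat \<Rightarrow> _"
proof -
  have "\<forall>k. \<exists>C. C \<in> sets borel \<and> small (S k \<inter> A - C) \<and> emeasure lborel C = trace_outer A (S k)"
    using trace_outer_hull by metis
  then obtain C where C: "\<And>k. C k \<in> sets borel" "\<And>k. small (S k \<inter> A - C k)"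
    "\<And>k. emeasure lborel (C k) = trace_outer A (S k)" by metis
  have "small (\<Union>k. S k \<inter> A - C k)" using C(2) by (rule small_UN)
  then have "small ((\<Union>k. S k) \<inter> A - (\<Union>k. C k))" by (rule small_subset) auto
  then have "trace_outer A (\<Union>k. S k) \<le> emeasure lborel (\<Union>k. C k)"
    using C(1) by (intro trace_outer_le) auto
  also have "\<dots> \<le> (\<Sum>k. emeasure lborel (C k))"
    using C(1) by (intro emeasure_subadditive_countably) auto
  finally show ?thesis by (simp add: C(3))
qed

text \<open>A hull of \<open>S\<close> cut along \<open>B\<close> covers both parts, up to small
  sets, with no loss of measure.\<close>

lemma trace_outer_split:
  assumes "B \<in> sets borel"
  shows "trace_outer A (B \<inter> S) + trace_outer A (S - B) \<le> trace_outer A S"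
proof -
  obtain C where C: "C \<in> sets borel" "small (S \<inter> A - C)" "emeasure lborel C = trace_outer A S"
    by (rule trace_outer_hull)
  have "trace_outer A (B \<inter> S) \<le> emeasure lborel (C \<inter> B)"
    using C assms by (intro trace_outer_le small_subset[OF C(2)]) auto
  moreover have "trace_outer A (S - B) \<le> emeasure lborel (C - B)"
    using C assms by (intro trace_outer_le small_subset[OF C(2)]) auto
  moreover have "emeasure lborel (C \<inter> B) + emeasure lborel (C - B) = emeasure lborel C"
    using C(1) assms by (subst plus_emeasure) (auto intro!: arg_cong[where f="emeasure lborel"])
  ultimately show ?thesis unfolding C(3)[symmetric] by (metis add_mono)
qed

lemma trace_outer_Isom_le:
  assumes f: "f \<in> Isom" and A: "small (inv f ` A - A)"
  shows "trace_outer A (f ` S) \<le> trace_outer A S"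
proof -
  obtain C where C: "C \<in> sets borel" "small (S \<inter> A - C)" "emeasure lborel C = trace_outer A S"
    by (rule trace_outer_hull)
  have "small (f ` (S \<inter> A - C) \<union> f ` (inv f ` A - A))"
    by (intro small_Un small_image C A)
  moreover have "f ` S \<inter> A - f ` C \<subseteq> f ` (S \<inter> A - C) \<union> f ` (inv f ` A - A)"
  proof
    fix y assume y: "y \<in> f ` S \<inter> A - f ` C"
    then obtain x where x: "x \<in> S" "y = f x" "x \<notin> C" by blast
    have "x \<in> inv f ` A" using y x(2) inv_f_f[OF Isom_inj[OF f], of x] by (metis DiffD1 IntD2 image_eqI)
    then show "y \<in> f ` (S \<inter> A - C) \<union> f ` (inv f ` A - A)" using x by blast
  qed
  ultimately have "small (f ` S \<inter> A - f ` C)" by (rule small_subset)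
  then have "trace_outer A (f ` S) \<le> emeasure lborel (f ` C)"
    using trace_outer_le Isom_borel_image[OF f C(1)] by blast
  also have "\<dots> \<le> trace_outer A S" using emeasure_Isom_image_le[OF f C(1)] C(3) by simp
  finally show ?thesis .
qed

text \<open>If a hull \<open>C\<close> missed a part of \<open>B\<close> of positive measure, that
  part would contain a closed set of positive measure. \<open>A\<close> meets such a set in a set
  that is not small, yet the intersection lies in the exceptional set of \<open>C\<close>.\<close>

lemma trace_outer_borel_ge:
  assumes A: "\<And>F. closed F \<Longrightarrow> \<not> small F \<Longrightarrow> \<not> small (A \<inter> F)" and B: "B \<in> sets borel"
  shows "emeasure lborel B \<le> trace_outer A B"
proof -
  obtain C where C: "C \<in> sets borel" "small (B \<inter> A - C)" "emeasure lborel C = trace_outer A B"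
    by (rule trace_outer_hull)
  have "emeasure lborel (B - C) = 0"
  proof (rule ccontr)
    assume ne: "emeasure lborel (B - C) \<noteq> 0"
    have BC: "B - C \<in> sets borel" using B C by simp
    then have "B - C \<in> sets lebesgue" by simp
    \<comment> \<open>A real tolerance is needed although \<open>B - C\<close> may have infinite
      measure. As the part outside \<open>F\<close> has measure below \<open>e\<close>,
      \<open>F\<close> cannot be null.\<close>
    obtain e :: real where e: "e > 0" "ennreal e \<le> emeasure lborel (B - C)"
    proof (cases "emeasure lborel (B - C)")
      case (real r)
      then show ?thesis using ne that[of r] by (cases "r = 0") auto
    next
      case top
      then show ?thesis using that[of 1] by simp
    qed
    obtain F where F: "closed F" "F \<subseteq> B - C" "emeasure lebesgue (B - C - F) < ennreal e"
      using sets_lebesgue_inner_closed[OF \<open>B - C \<in> sets lebesgue\<close> e(1)] by metis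
    have "emeasure lborel F \<noteq> 0"
    proof
      assume "emeasure lborel F = 0"
      then have "F \<in> null_sets lborel" using F(1) by auto
      then have "emeasure lborel (B - C - F) = emeasure lborel (B - C)"
        using BC by (intro emeasure_Diff_null_set) auto
      moreover have "emeasure lebesgue (B - C - F) = emeasure lborel (B - C - F)"
        using BC F(1) by simp
      ultimately show False using F(3) e(2) by simp
    qed
    then have "\<not> small (A \<inter> F)" using A F(1) not_small_closed by blast
    moreover have "A \<inter> F \<subseteq> B \<inter> A - C" using F(2) by blast
    ultimately show False using C(2) small_subset by blast
  qed
  have "emeasure lborel B \<le> emeasure lborel (C \<union> (B - C))"
    using B C by (intro emeasure_mono) auto
  also have "\<dots> \<le> emeasure lborel C + emeasure lborel (B - C)"
    using B C by (intro emeasure_subadditive) auto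
  finally show ?thesis using C(3) \<open>emeasure lborel (B - C) = 0\<close> by simp
qed

section \<open>The sum of the trace outer measures and its Caratheodory sets\<close>

theorem corollary1p3:
  shows "\<exists>(\<A> :: (real ^ 'n::finite) set set) (\<mu> :: (real ^ 'n) measure).
    sigma_algebra UNIV \<A> \<and>
    isometry_invariant_algebra \<A> \<and>
    sets borel \<subseteq> \<A> \<and>
    space \<mu> = UNIV \<and> sets \<mu> = \<A> \<and>
    isometry_invariant_measure \<mu> \<and>
    sigma_finite_measure \<mu> \<and>
    (\<forall>c::real. c \<ge> 0 \<longrightarrow>
      \<not> (\<forall>B \<in> sets borel. emeasure \<mu> B = ennreal c * emeasure lborel B))"
proof -
  \<comment> \<open>By \<open>not_small_closed\<close> these targets include every closed set of
    positive measure.\<close>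
  define \<F> where "\<F> = {F :: (real ^ 'n) set. closed F \<and> \<not> small F}"
  have "UNIV \<in> \<F>" unfolding \<F>_def using not_small_closed[of "UNIV :: (real ^ 'n) set"] by simp
  have "\<F> \<lesssim> {F :: (real ^ 'n) set. closed F}"
    by (rule subset_imp_lepoll) (auto simp: \<F>_def)
  then have \<F>: "\<F> \<lesssim> (UNIV :: nat set set)"
    using closed_sets_lepoll_continuum lepoll_trans by blast
  have "(id :: real ^ 'n \<Rightarrow> _) \<in> Isom" by (simp add: Isom_def)
  obtain A :: "nat \<Rightarrow> (real ^ 'n) set"
    where disj: "disjoint_family A"
      and inv: "\<And>f n. f \<in> Isom \<Longrightarrow> small (f ` A n - A n)"
      and large: "\<And>F n. F \<in> \<F> \<Longrightarrow> \<not> small (A n \<inter> F)"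
    by (rule almost_invariant_family[OF Isom_lepoll_continuum Isom_inj _ \<F>])
      (use \<open>UNIV \<in> \<F>\<close> \<open>id \<in> Isom\<close> in \<open>auto simp: \<F>_def\<close>)
  define m where "m S = (\<Sum>n. trace_outer (A n) S)" for S
  have m_mono: "m S \<le> m T" if "S \<subseteq> T" for S T
    unfolding m_def using that by (intro suminf_le trace_outer_mono) auto
  have m_subadd: "m (\<Union>k. S k) \<le> (\<Sum>k. m (S k))" for S :: "nat \<Rightarrow> _"
  proof -
    have "m (\<Union>k. S k) \<le> (\<Sum>n k. trace_outer (A n) (S k))"
      unfolding m_def by (intro suminf_le trace_outer_subadditive) auto
    \<comment> \<open>The double series is rearranged by reading one sum as an integral over
      counting measure.\<close>
    also have "\<dots> = (\<integral>\<^sup>+n. (\<Sum>k. trace_outer (A n) (S k)) \<partial>count_space UNIV)"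
      by (simp add: nn_integral_count_space_nat)
    also have "\<dots> = (\<Sum>k. \<integral>\<^sup>+n. trace_outer (A n) (S k) \<partial>count_space UNIV)"
      by (rule nn_integral_suminf) simp
    finally show ?thesis by (simp add: nn_integral_count_space_nat m_def)
  qed
  have m_empty: "m {} = 0" unfolding m_def by (simp add: trace_outer_disjoint)
  have outer: "outer_measure_space (Pow UNIV) m"
    unfolding outer_measure_space_def positive_def increasing_def countably_subadditive_def
    using m_mono m_subadd m_empty by simp
  have m_Un: "m X \<le> m (L \<inter> X) + m (X - L)" for L X
  proof -
    \<comment> \<open>Two sets padded with empty ones, to get finite from countable
      subadditivity.\<close>
    define S where "S k = (if k = 0 then L \<inter> X else if k = 1 then X - L else {})" for k :: nat
    have "X = (\<Union>k. S k)" unfolding S_def by (auto split: if_splits)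
    moreover have "(\<Sum>k. m (S k)) = (\<Sum>k\<in>{0, 1}. m (S k))"
      by (rule suminf_finite) (auto simp: S_def m_empty)
    ultimately show ?thesis using m_subadd[of S] by (simp add: S_def)
  qed
  define \<A> where "\<A> = lambda_system UNIV (Pow UNIV) m"
  have \<A>_iff: "L \<in> \<A> \<longleftrightarrow> (\<forall>X. m (L \<inter> X) + m (X - L) = m X)" for L
    unfolding \<A>_def lambda_system_def by (simp add: Diff_eq Int_commute)
  have \<A>I: "L \<in> \<A>" if "\<And>X. m (L \<inter> X) + m (X - L) \<le> m X" for L
    unfolding \<A>_iff using that m_Un by (simp add: antisym)
  have ms: "measure_space UNIV \<A> m"
    unfolding \<A>_def by (rule sigma_algebra.caratheodory_lemma[OF sigma_algebra_Pow outer])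
  then have sa: "sigma_algebra UNIV \<A>" by (simp add: measure_space_def)
  define \<mu> where "\<mu> = measure_of UNIV \<A> m"
  have space: "space \<mu> = UNIV" and sets: "sets \<mu> = \<A>"
    unfolding \<mu>_def using sigma_algebra.sets_measure_of_eq[OF sa] by (simp_all add: space_measure_of_conv)
  have em: "emeasure \<mu> L = m L" if "L \<in> \<A>" for L
    unfolding \<mu>_def using ms that
    by (intro emeasure_measure_of_sigma) (auto simp: measure_space_def)
  have borel: "B \<in> \<A>" if "B \<in> sets borel" for B
  proof (rule \<A>I)
    fix X
    have "m (B \<inter> X) + m (X - B) = (\<Sum>n. trace_outer (A n) (B \<inter> X) + trace_outer (A n) (X - B))"
      unfolding m_def by (rule suminf_add) auto
    also have "\<dots> \<le> m X"
      unfolding m_def by (intro suminf_le trace_outer_split that) auto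
    finally show "m (B \<inter> X) + m (X - B) \<le> m X" .
  qed
  have A_disj: "n \<noteq> k \<Longrightarrow> A n \<inter> A k = {}" for n k
    using disj by (auto simp: disjoint_family_on_def)
  have pieces: "A k \<in> \<A>" for k
  proof (rule \<A>I)
    fix X
    \<comment> \<open>In each summand one of the two parts misses \<open>A n\<close>: the second if
      \<open>n = k\<close>, the first otherwise.\<close>
    have "trace_outer (A n) (A k \<inter> X) + trace_outer (A n) (X - A k) \<le> trace_outer (A n) X" for n
    proof (cases "n = k")
      case True
      then have "trace_outer (A n) (X - A k) = 0" by (intro trace_outer_disjoint) auto
      then show ?thesis using trace_outer_mono[of "A k \<inter> X" "A n" X] by auto
    next
      case False
      then have "trace_outer (A n) (A k \<inter> X) = 0"
        using A_disj by (intro trace_outer_disjoint) blast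
      then show ?thesis using trace_outer_mono[of "X - A k" "A n" X] by auto
    qed
    then have "(\<Sum>n. trace_outer (A n) (A k \<inter> X) + trace_outer (A n) (X - A k)) \<le> m X"
      unfolding m_def by (intro suminf_le) auto
    moreover have "m (A k \<inter> X) + m (X - A k) = (\<Sum>n. trace_outer (A n) (A k \<inter> X) + trace_outer (A n) (X - A k))"
      unfolding m_def by (rule suminf_add) auto
    ultimately show "m (A k \<inter> X) + m (X - A k) \<le> m X" by simp
  qed
  have m_le: "m (f ` S) \<le> m S" if "f \<in> Isom" for f S
    unfolding m_def using inv[OF Isom_inv[OF that]] by (intro suminf_le trace_outer_Isom_le that) auto
  have m_inv: "m (f ` S) = m S" if f: "f \<in> Isom" for f S
    using m_le[OF f, of S] m_le[OF Isom_inv[OF f], of "f ` S"]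
    by (simp add: image_inv_f_f[OF Isom_inj[OF f]] antisym)
  have \<A>_inv: "f ` L \<in> \<A>" if f: "f \<in> Isom" and L: "L \<in> \<A>" for f L
    unfolding \<A>_iff
  proof
    fix X
    have X: "X = f ` (f -` X)" using Isom_bij[OF f] by (simp add: bij_is_surj)
    have "f ` L \<inter> X = f ` (L \<inter> f -` X)" "X - f ` L = f ` (f -` X - L)"
      using X image_Int[OF Isom_inj[OF f]] image_set_diff[OF Isom_inj[OF f]] by metis+
    then have "m (f ` L \<inter> X) + m (X - f ` L) = m (f -` X)"
      using L by (simp add: m_inv[OF f] \<A>_iff)
    also have "\<dots> = m X" using m_inv[OF f, of "f -` X"] X by simp
    finally show "m (f ` L \<inter> X) + m (X - f ` L) = m X" .
  qed
  have "sigma_finite_measure \<mu>"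
  proof
    \<comment> \<open>The complement of all \<open>A n\<close> has measure zero, and a bounded part
      of \<open>A n\<close> is charged only by the \<open>n\<close>-th summand, by at most the
      volume of a ball.\<close>
    define Z where "Z = insert (- (\<Union>n. A n)) (range (\<lambda>(n, k). A n \<inter> cball 0 (real k)))"
    have "countable Z" unfolding Z_def by simp
    interpret sigma_algebra UNIV \<A> by (rule sa)
    have "(\<Union>n. A n) \<in> \<A>" using pieces by blast
    then have compl: "- (\<Union>n. A n) \<in> \<A>" using compl_sets by (simp add: Compl_eq_Diff_UNIV)
    have ball: "A n \<inter> cball 0 (real k) \<in> \<A>" for n k using pieces borel by auto
    have "Z \<subseteq> \<A>" using compl ball by (auto simp: Z_def)
    moreover have "\<Union> Z = UNIV"
    proof -
      have "x \<in> \<Union> Z" for x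
      proof (cases "\<exists>n. x \<in> A n")
        case True
        then obtain n where n: "x \<in> A n" by blast
        obtain k where k: "norm x \<le> real k" using real_arch_simple by blast
        have "x \<in> A n \<inter> cball 0 (real k)" using n k by simp
        moreover have "A n \<inter> cball 0 (real k) \<in> Z"
          unfolding Z_def by (intro insertI2 image_eqI[of _ _ "(n, k)"]) auto
        ultimately show ?thesis by (rule UnionI[rotated])
      qed (auto simp: Z_def)
      then show ?thesis by blast
    qed
    moreover have "emeasure \<mu> L \<noteq> \<infinity>" if "L \<in> Z" for L
    proof -
      have "trace_outer (A n) (- (\<Union>n. A n)) = 0" for n by (rule trace_outer_disjoint) blast
      then have "m (- (\<Union>n. A n)) = 0" unfolding m_def by (simp only: suminf_zero)
      have finite_piece: "m (A n \<inter> cball 0 (real k)) < \<infinity>" for n k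
      proof -
        have "m (A n \<inter> cball 0 (real k)) = (\<Sum>j\<in>{n}. trace_outer (A j) (A n \<inter> cball 0 (real k)))"
          unfolding m_def using A_disj by (intro suminf_finite trace_outer_disjoint) auto
        also have "\<dots> \<le> emeasure lborel (cball (0 :: real ^ 'n) (real k))"
          using trace_outer_le[of "cball 0 (real k)" "A n \<inter> cball 0 (real k)" "A n"]
          by (simp add: Diff_eq Int_ac)
        also have "\<dots> < \<infinity>" by (rule emeasure_lborel_cball_finite)
        finally show ?thesis .
      qed
      from that consider "L = - (\<Union>n. A n)" | n k where "L = A n \<inter> cball 0 (real k)"
        unfolding Z_def by (elim insertE imageE) auto
      then show ?thesis
      proof cases
        case 1
        then show ?thesis using em[OF compl] \<open>m (- (\<Union>n. A n)) = 0\<close> by (simp only:) simp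
      next
        case (2 n k)
        then show ?thesis using em[OF ball, of n k] finite_piece[of n k] by simp
      qed
    qed
    ultimately show "\<exists>Z. countable Z \<and> Z \<subseteq> sets \<mu> \<and> \<Union> Z = space \<mu> \<and> (\<forall>a\<in>Z. emeasure \<mu> a \<noteq> \<infinity>)"
      using \<open>countable Z\<close> unfolding space sets by (intro exI[of _ Z] conjI ballI)
  qed
  moreover have "\<not> (\<forall>B \<in> sets borel. emeasure \<mu> B = ennreal c * emeasure lborel B)" for c :: real
  proof
    assume eq: "\<forall>B \<in> sets borel. emeasure \<mu> B = ennreal c * emeasure lborel B"
    define Q where "Q = cbox (0 :: real ^ 'n) One"
    have Q: "Q \<in> sets borel" "emeasure lborel Q = 1"
      unfolding Q_def by (simp_all add: emeasure_lborel_cbox_eq)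
    \<comment> \<open>Every summand gives the unit cube at least its volume, so \<open>m Q\<close>
      is infinite, whereas \<open>ennreal c\<close> is finite.\<close>
    have "1 \<le> trace_outer (A n) Q" for n
      using trace_outer_borel_ge[of "A n" Q] large Q by (simp add: \<F>_def)
    then have "(\<Sum>n::nat. 1 :: ennreal) \<le> m Q" unfolding m_def by (intro suminf_le) auto
    moreover have "(\<Sum>n::nat. 1 :: ennreal) = \<infinity>"
      using nn_integral_count_space_nat[of "\<lambda>_. 1"] by (simp add: emeasure_count_space)
    moreover have "m Q = ennreal c" using eq Q em[OF borel[OF Q(1)]] by simp
    ultimately show False by (simp add: top_unique)
  qed
  ultimately show ?thesis
    using sa borel space sets \<A>_inv m_inv em
    unfolding isometry_invariant_algebra_def isometry_invariant_measure_def
    by (intro exI[of _ \<A>] exI[of _ \<mu>]) auto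
qed

end
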